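(* Let $X$ be a real or complex Banach space with dual space $X^*$, let $A:\mathbb{N}\to\mathcal{B}(X)$ be a sequence, and consider the linear discrete-time system $x_{n+1}=A(n)x_n$ with associated operators $A_m^n$, $(m,n)\in\Delta$. The following statements are equivalent: (i) the system is uniformly exponentially stable; (ii) there are constants $B\ge1$ and $b>0$ such that $\sum_{k=0}^{m}e^{b(m-k)}\|(A_m^k)^*x^*\|\le B\|x^*\|$ for all $m\in\mathbb{N}$ and $x^*\in X^*$; (iii) there exists a constant $B\ge1$ such that $\sum_{k=0}^{m}\|(A_m^k)^*x^*\|\le B\|x^*\|$ for all $m\in\mathbb{N}$ and $x^*\in X^*$.
   Context: $\mathbb{N}=\{0,1,2,\dots\}$. $\mathcal{B}(X)$ is the Banach algebra of bounded linear operators on $X$, and $I$ is the identity operator. $\Delta$ is the set of pairs $(m,n)$ of nonnegative integers with $m\ge n$. $T$ is the set of triples $(m,n,p)$ of nonnegative integers with $(m,n)\in\Delta$ and $(n,p)\in\Delta$. For $(m,n)\in\Delta$, $A_m^n=A(m)A(m-1)\cdots A(n+1)$ if $m\ge n+1$, and $A_m^n=I$ if $m=n$. $X^*$ is the Banach space of continuous linear functionals on $X$, and $(A_m^k)^*:X^*\to X^*$ is the adjoint (dual) operator of $A_m^k$. The system is uniformly exponentially stable if there are constants $N\ge1$ and $\alpha>0$ such that $\|A_m^p x\|\le N e^{-\alpha(m-n)}\|A_n^p x\|$ for all $(m,n,p)\in T$ and $x\in X$. *)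

theory Defs
  imports "HOL-Analysis.Analysis"
begin

text \<open>
  The scalar field is real or complex, with its usual absolute value. The class below
  has exactly these two fields as instances, up to isometric isomorphism.
\<close>

class real_or_complex_field = real_normed_field +
  assumes ex_isometry_real_or_complex:
    "\<exists>\<phi> :: 'a \<Rightarrow> complex.
       \<phi> 1 = 1 \<and> (\<forall>x y. \<phi> (x + y) = \<phi> x + \<phi> y) \<and> (\<forall>x y. \<phi> (x * y) = \<phi> x * \<phi> y) \<and>
       (\<forall>x. norm (\<phi> x) = norm x) \<and> (range \<phi> = \<real> \<or> range \<phi> = UNIV)"

instance real :: real_or_complex_field
  by standard (rule exI[of _ complex_of_real], simp add: Reals_def)

instance complex :: real_or_complex_field
  by standard (rule exI[of _ "\<lambda>z. z"], simp)

text \<open>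
  Class \<open>banach\<close> provides the norm, its completeness and the underlying real
  structure, with which the scalar multiplication \<open>smul\<close> has to agree.
\<close>

locale banach_space_over = vector_space smul
  for smul :: "'k::real_or_complex_field \<Rightarrow> 'a::banach \<Rightarrow> 'a" +
  assumes norm_scale: "norm (smul c x) = norm c * norm x"
    and scale_of_real: "smul (of_real r) x = r *\<^sub>R x"

lemma banach_space_over_real: "banach_space_over ((*\<^sub>R) :: real \<Rightarrow> 'a::banach \<Rightarrow> 'a)"
  by standard (simp_all add: algebra_simps)

lemma banach_space_over_complex: "banach_space_over ((*) :: complex \<Rightarrow> complex \<Rightarrow> complex)"
  by standard (simp_all add: algebra_simps norm_mult scaleR_conv_of_real)

text \<open>
  Elements of the type of bounded linear maps are only real-linear, so linearity over the
  scalar field is required separately. For real scalars it holds automatically. The norm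
  is in all cases the operator norm of the library.
\<close>

definition bounded_operators ::
    "('k::real_or_complex_field \<Rightarrow> 'a::banach \<Rightarrow> 'a) \<Rightarrow> ('a \<Rightarrow>\<^sub>L 'a) set" where
  "bounded_operators smul = {S. Vector_Spaces.linear smul smul (blinfun_apply S)}"

definition dual_space ::
    "('k::real_or_complex_field \<Rightarrow> 'a::banach \<Rightarrow> 'a) \<Rightarrow> ('a \<Rightarrow>\<^sub>L 'k) set" where
  "dual_space smul = {f. Vector_Spaces.linear smul (*) (blinfun_apply f)}"

definition dual_operator ::
    "('a::banach \<Rightarrow>\<^sub>L 'a) \<Rightarrow> ('a \<Rightarrow>\<^sub>L 'k::real_or_complex_field) \<Rightarrow> ('a \<Rightarrow>\<^sub>L 'k)" where
  "dual_operator S f = f o\<^sub>L S"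

lemma dual_operator_in_dual_space:
  assumes "S \<in> bounded_operators smul" "f \<in> dual_space smul"
  shows "dual_operator S f \<in> dual_space smul"
proof -
  have "Vector_Spaces.linear smul (*) (blinfun_apply f \<circ> blinfun_apply S)"
    using assms unfolding bounded_operators_def dual_space_def
    by (blast intro: Vector_Spaces.linear_compose)
  moreover have "blinfun_apply (f o\<^sub>L S) = blinfun_apply f \<circ> blinfun_apply S"
    by (simp add: fun_eq_iff)
  ultimately show ?thesis
    by (simp add: dual_space_def dual_operator_def)
qed

text \<open>
  \<open>evol A m n\<close> is the product \<open>A(m) A(m-1) \<dots> A(n+1)\<close> for \<open>m > n\<close> and the identity for
  \<open>m = n\<close>. Its value (the identity) for \<open>m < n\<close> is irrelevant.
\<close>

primrec evol :: "(nat \<Rightarrow> 'a::banach \<Rightarrow>\<^sub>L 'a) \<Rightarrow> nat \<Rightarrow> nat \<Rightarrow> 'a \<Rightarrow>\<^sub>L 'a" where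
  "evol A 0 n = id_blinfun"
| "evol A (Suc m) n = (if n \<le> m then A (Suc m) o\<^sub>L evol A m n else id_blinfun)"

definition uniformly_exponentially_stable :: "(nat \<Rightarrow> 'a::banach \<Rightarrow>\<^sub>L 'a) \<Rightarrow> bool" where
  "uniformly_exponentially_stable A \<longleftrightarrow>
     (\<exists>N \<alpha> :: real. N \<ge> 1 \<and> \<alpha> > 0 \<and>
        (\<forall>m n p x. m \<ge> n \<and> n \<ge> p \<longrightarrow>
           norm (evol A m p x) \<le> N * exp (- \<alpha> * (real m - real n)) * norm (evol A n p x)))"

end

theory Submission
  imports Defs
begin

text \<open>
  Condition (iii) controls \<open>A\<^sub>m\<^sup>k\<close> only through functionals, so Hahn--Banach is needed to turn it
  into \<open>\<parallel>A\<^sub>k\<^sup>n\<parallel> \<le> B\<close>. As \<open>f \<circ> A\<^sub>m\<^sup>n = (f \<circ> A\<^sub>m\<^sup>k) \<circ> A\<^sub>k\<^sup>n\<close>, summing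
  \<open>\<parallel>f \<circ> A\<^sub>m\<^sup>n\<parallel> \<le> B \<parallel>f \<circ> A\<^sub>m\<^sup>k\<parallel>\<close> over \<open>n \<le> k \<le> m\<close> gives
  \<open>(m - n + 1) \<parallel>A\<^sub>m\<^sup>n\<parallel> \<le> B\<^sup>2\<close> (Datko's argument), and the cocycle property upgrades this decay to an
  exponential one. The real Hahn--Banach theorem is obtained from the fact that a
  minimal sublinear functional is additive.
\<close>

section \<open>The Hahn--Banach theorem\<close>

definition sublinear :: "('a::real_vector \<Rightarrow> real) \<Rightarrow> bool" where
  "sublinear q \<longleftrightarrow> (\<forall>x y. q (x + y) \<le> q x + q y) \<and> (\<forall>r\<ge>0. \<forall>x. q (r *\<^sub>R x) = r * q x)"

text \<open>The one-sided bound at \<open>inverse r\<close> yields the reverse inequality, so one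
  direction suffices; for infima it is the one that is easy to obtain.\<close>

lemma sublinearI:
  assumes "\<And>x y. q (x + y) \<le> q x + q y" and "q 0 = 0"
    and pos: "\<And>r x. r > 0 \<Longrightarrow> q (r *\<^sub>R x) \<le> r * q x"
  shows "sublinear q"
proof -
  have "q (r *\<^sub>R x) = r * q x" if "r \<ge> 0" for r x
  proof (cases "r = 0")
    case False
    then have r: "r > 0" using that by simp
    have "q (inverse r *\<^sub>R (r *\<^sub>R x)) \<le> inverse r * q (r *\<^sub>R x)"
      using r by (intro pos) simp
    then have "r * q x \<le> q (r *\<^sub>R x)"
      using r by (simp add: field_simps)
    then show ?thesis using pos[OF r, of x] by simp
  qed (use assms in simp)
  then show ?thesis using assms(1) unfolding sublinear_def by blast
qed

lemma
  assumes "sublinear q"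
  shows sublinear_add: "q (x + y) \<le> q x + q y"
    and sublinear_scaleR: "r \<ge> 0 \<Longrightarrow> q (r *\<^sub>R x) = r * q x"
    and sublinear_zero: "q 0 = 0"
    and sublinear_minus: "- q (- x) \<le> q x"
proof -
  show add: "q (x + y) \<le> q x + q y" for x y using assms by (simp add: sublinear_def)
  show sc: "r \<ge> 0 \<Longrightarrow> q (r *\<^sub>R x) = r * q x" for r x using assms by (simp add: sublinear_def)
  show z: "q 0 = 0" using sc[of 0 0] by simp
  show "- q (- x) \<le> q x" using add[of x "- x"] z by simp
qed

lemma sublinear_norm: "sublinear (norm :: 'a::real_normed_vector \<Rightarrow> real)"
  by (simp add: sublinear_def norm_triangle_ineq)

text \<open>The largest sublinear functional below \<open>q\<close> with value at most \<open>- q y\<close> at \<open>- y\<close>.\<close>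

definition push_down :: "('a::real_vector \<Rightarrow> real) \<Rightarrow> 'a \<Rightarrow> 'a \<Rightarrow> real" where
  "push_down q y x = (INF t\<in>{0..}. q (x + t *\<^sub>R y) - t * q y)"

lemma push_down_le:
  assumes q: "sublinear q" and t: "t \<ge> 0"
  shows "push_down q y x \<le> q (x + t *\<^sub>R y) - t * q y"
proof -
  \<comment> \<open>A real \<open>INF\<close> is informative only over a set that is bounded below.
    Here \<open>- q (- x)\<close> is a bound independent of \<open>t\<close>, because
    \<open>t * q y = q (t *\<^sub>R y)\<close> and \<open>t *\<^sub>R y\<close> is the sum of
    \<open>x + t *\<^sub>R y\<close> and \<open>- x\<close>.\<close>
  have "- q (- x) \<le> q (x + t *\<^sub>R y) - t * q y" if "t \<ge> 0" for t
    using sublinear_add[OF q, of "x + t *\<^sub>R y" "- x"] sublinear_scaleR[OF q that, of y] by simp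
  then have "bdd_below ((\<lambda>t. q (x + t *\<^sub>R y) - t * q y) ` {0..})"
    by (intro bdd_belowI2[of _ "- q (- x)"]) simp
  then show ?thesis
    unfolding push_down_def by (rule cINF_lower) (use t in simp)
qed

lemma push_down_greatest:
  assumes "\<And>t. t \<ge> 0 \<Longrightarrow> a \<le> q (x + t *\<^sub>R y) - t * q y"
  shows "a \<le> push_down q y x"
  unfolding push_down_def using assms by (intro cINF_greatest) auto

text \<open>Parameters \<open>s\<close> for \<open>u\<close> and \<open>t\<close> for
  \<open>v\<close> combine to the parameter \<open>s + t\<close> for \<open>u + v\<close>; for
  homogeneity the parameter \<open>t\<close> is rescaled to \<open>r * t\<close>.\<close>

lemma sublinear_push_down:
  assumes q: "sublinear q"
  shows "sublinear (push_down q y)"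
proof (rule sublinearI)
  fix u v
  have *: "push_down q y (u + v) - (q (v + t *\<^sub>R y) - t * q y) \<le> q (u + s *\<^sub>R y) - s * q y"
    if "s \<ge> 0" "t \<ge> 0" for s t
    using push_down_le[OF q, of "s + t" y "u + v"] that
      sublinear_add[OF q, of "u + s *\<^sub>R y" "v + t *\<^sub>R y"]
    by (simp add: algebra_simps)
  \<comment> \<open>Infimum over \<open>s\<close> with \<open>t\<close> fixed; the infimum over
    \<open>t\<close> follows.\<close>
  have "push_down q y (u + v) - push_down q y u \<le> q (v + t *\<^sub>R y) - t * q y" if "t \<ge> 0" for t
    using push_down_greatest[of _ q u y, OF *[OF _ that]] by simp
  from push_down_greatest[of _ q v y, OF this]
  show "push_down q y (u + v) \<le> push_down q y u + push_down q y v" by simp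
next
  have "0 \<le> push_down q y 0"
    by (rule push_down_greatest) (simp add: sublinear_scaleR[OF q])
  moreover have "push_down q y 0 \<le> 0"
    using push_down_le[OF q, of 0 y 0] by (simp add: sublinear_zero[OF q])
  ultimately show "push_down q y 0 = 0" by simp
next
  fix r :: real and x
  assume r: "r > 0"
  have "push_down q y (r *\<^sub>R x) / r \<le> q (x + t *\<^sub>R y) - t * q y" if "t \<ge> 0" for t
  proof -
    have "q (r *\<^sub>R x + (r * t) *\<^sub>R y) = r * q (x + t *\<^sub>R y)"
      using sublinear_scaleR[OF q, of r "x + t *\<^sub>R y"] r by (simp add: scaleR_add_right)
    then show ?thesis
      using push_down_le[OF q, of "r * t" y "r *\<^sub>R x"] r that by (simp add: field_simps)
  qed
  then have "push_down q y (r *\<^sub>R x) / r \<le> push_down q y x" by (rule push_down_greatest)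
  then show "push_down q y (r *\<^sub>R x) \<le> r * push_down q y x" using r by (simp add: field_simps)
qed

text \<open>An infimum of sublinear functionals need not be subadditive. In a chain the smaller of
  \<open>q\<close> and \<open>r\<close> lies below both, so a single \<open>s\<close> gives
  \<open>s x + s y \<le> q x + r y\<close>.\<close>

lemma sublinear_INF_chain:
  fixes C :: "('a::real_vector \<Rightarrow> real) set"
  assumes ne: "C \<noteq> {}" and sub: "\<And>q. q \<in> C \<Longrightarrow> sublinear q"
    and chain: "\<And>q r. q \<in> C \<Longrightarrow> r \<in> C \<Longrightarrow> q \<le> r \<or> r \<le> q"
    and bdd: "\<And>x. bdd_below ((\<lambda>q. q x) ` C)"
  shows "sublinear (\<lambda>x. INF q\<in>C. q x)"
proof (rule sublinearI)
  fix x y :: 'a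
  have le: "(INF q\<in>C. q z) \<le> q z" if "q \<in> C" for q z
    using bdd that by (rule cINF_lower)
  have *: "(INF q\<in>C. q (x + y)) - r y \<le> q x" if qr: "q \<in> C" "r \<in> C" for q r
  proof -
    obtain s where s: "s \<in> C" "s \<le> q" "s \<le> r" using chain[OF qr] qr by blast
    have "(INF q\<in>C. q (x + y)) \<le> s x + s y"
      using le[OF s(1)] sublinear_add[OF sub[OF s(1)]] order_trans by blast
    also have "\<dots> \<le> q x + r y" using s by (auto intro: add_mono simp: le_fun_def)
    finally show ?thesis by simp
  qed
  have "(INF q\<in>C. q (x + y)) - (INF q\<in>C. q x) \<le> r y" if "r \<in> C" for r
    using cINF_greatest[OF ne, of "(INF q\<in>C. q (x + y)) - r y" "\<lambda>q. q x"] *[OF _ that] by fastforce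
  then have "(INF q\<in>C. q (x + y)) - (INF q\<in>C. q x) \<le> (INF q\<in>C. q y)"
    by (rule cINF_greatest[OF ne])
  then show "(INF q\<in>C. q (x + y)) \<le> (INF q\<in>C. q x) + (INF q\<in>C. q y)" by simp
next
  have "(\<lambda>q. q 0) ` C = {0}" using ne sublinear_zero[OF sub] by force
  then show "(INF q\<in>C. q 0) = 0" by simp
next
  fix r :: real and x :: 'a
  assume r: "r > 0"
  have "(INF q\<in>C. q (r *\<^sub>R x)) / r \<le> q x" if "q \<in> C" for q
    using cINF_lower[OF bdd[of "r *\<^sub>R x"] that] sublinear_scaleR[OF sub[OF that], of r x] r
    by (simp add: field_simps)
  then have "(INF q\<in>C. q (r *\<^sub>R x)) / r \<le> (INF q\<in>C. q x)" by (rule cINF_greatest[OF ne])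
  then show "(INF q\<in>C. q (r *\<^sub>R x)) \<le> r * (INF q\<in>C. q x)" using r by (simp add: field_simps)
qed

section \<open>The real Hahn--Banach theorem by minimality\<close>

text \<open>Minimality forces \<open>push_down q y = q\<close>, and the parameter value 1 in the
  infimum then gives \<open>q x + q y \<le> q (x + y)\<close>. Additivity makes \<open>q\<close>
  odd, which extends homogeneity to negative scalars.\<close>

lemma minimal_sublinear_linear:
  assumes q: "sublinear q" and min: "\<And>r. sublinear r \<Longrightarrow> r \<le> q \<Longrightarrow> r = q"
  shows "linear q"
proof -
  have "push_down q y = q" for y
  proof (rule min[OF sublinear_push_down[OF q]])
    show "push_down q y \<le> q"
      using push_down_le[OF q, of 0 y] by (auto simp: le_fun_def)
  qed
  then have "q x \<le> q (x + y) - q y" for x y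
    using push_down_le[OF q, of 1 y x] by simp
  then have add: "q (x + y) = q x + q y" for x y
    using sublinear_add[OF q, of x y] by (simp add: antisym le_diff_eq)
  have neg: "q (- x) = - q x" for x
    using add[of x "- x"] sublinear_zero[OF q] by simp
  have "q (r *\<^sub>R x) = r *\<^sub>R q x" for r x
  proof (cases "r \<ge> 0")
    case False
    then show ?thesis
      using sublinear_scaleR[OF q, of "- r" x] neg[of "r *\<^sub>R x"] by simp
  qed (simp add: sublinear_scaleR[OF q])
  with add show ?thesis by (intro linearI)
qed

lemma ex_linear_le_sublinear:
  fixes p :: "'a::real_vector \<Rightarrow> real"
  assumes p: "sublinear p"
  shows "\<exists>g. linear g \<and> g \<le> p"
proof -
  let ?S = "{q. sublinear q \<and> q \<le> p}"
  have "\<exists>m\<in>?S. \<forall>a\<in>?S. m \<ge> a \<longrightarrow> a = m"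
  proof (rule predicate_Zorn)
    \<comment> \<open>With the order reversed, the maximal element supplied by Zorn's lemma is a
      minimal functional.\<close>
    show "partial_order_on ?S (relation_of (\<ge>) ?S)"
      by (rule partial_order_on_relation_ofI) auto
  next
    fix C assume C: "C \<in> Chains (relation_of (\<ge>) ?S)"
    have CS: "C \<subseteq> ?S" using C by (rule Chains_relation_of)
    show "\<exists>u\<in>?S. \<forall>a\<in>C. a \<ge> u"
    proof (cases "C = {}")
      case True
      then show ?thesis using p by auto
    next
      case False
      let ?u = "\<lambda>x. INF q\<in>C. q x"
      \<comment> \<open>All members of the chain share this lower bound at \<open>x\<close>, since
        \<open>- p (- x) \<le> - q (- x) \<le> q x\<close>; hence their pointwise infimum is a
        genuine one.\<close>
      have "- p (- x) \<le> q x" if "q \<in> C" for q x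
      proof -
        have "sublinear q" "q (- x) \<le> p (- x)" using that CS by (auto simp: le_fun_def)
        then show ?thesis using sublinear_minus[of q x] by linarith
      qed
      then have bdd: "bdd_below ((\<lambda>q. q x) ` C)" for x
        by (intro bdd_belowI2[of _ "- p (- x)"])
      have le: "?u \<le> q" if "q \<in> C" for q
        using cINF_lower[OF bdd that] by (simp add: le_fun_def)
      have "sublinear ?u"
      proof (rule sublinear_INF_chain[OF False _ _ bdd])
        show "sublinear q" if "q \<in> C" for q using that CS by blast
        show "q \<le> r \<or> r \<le> q" if "q \<in> C" "r \<in> C" for q r
          using C that by (auto simp: Chains_def relation_of_def)
      qed
      moreover have "?u \<le> p" using False le CS by (blast intro: order_trans)
      ultimately show ?thesis using le by blast
    qed
  qed
  then obtain q where "sublinear q" "q \<le> p" "\<And>r. sublinear r \<Longrightarrow> r \<le> p \<Longrightarrow> r \<le> q \<Longrightarrow> r = q"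
    by auto
  then show ?thesis using minimal_sublinear_linear[of q] order_trans by blast
qed

text \<open>Instead of extending a functional from the span of \<open>x0\<close>, a linear one is
  taken below \<open>push_down norm x0\<close>, whose value at \<open>- x0\<close> is at most
  \<open>- norm x0\<close>. This forces equality at \<open>x0\<close>.\<close>

lemma real_norming_functional:
  fixes x0 :: "'a::real_normed_vector"
  shows "\<exists>g. linear g \<and> (\<forall>x. g x \<le> norm x) \<and> g x0 = norm x0"
proof -
  let ?p = "push_down norm x0"
  obtain g where g: "linear g" "g \<le> ?p"
    using ex_linear_le_sublinear sublinear_push_down sublinear_norm by blast
  have "?p x \<le> norm x" for x
    using push_down_le[OF sublinear_norm, of 0 x0 x] by simp
  then have le: "g x \<le> norm x" for x using g(2) by (meson le_funD order_trans)
  have "?p (- x0) \<le> - norm x0"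
    using push_down_le[OF sublinear_norm, of 1 x0 "- x0"] by simp
  then have "- g x0 \<le> - norm x0"
    using le_funD[OF g(2), of "- x0"] linear_neg[OF g(1), of x0] by simp
  then show ?thesis using g(1) le le[of x0] by (intro exI[of _ g]) auto
qed

section \<open>Norming functionals over real or complex scalars\<close>

text \<open>Replaces the abstract isometry by coordinates: in the complex case \<open>j\<close> is
  an imaginary unit, and the last property bounds the real part by the modulus. Since \<phi> is not
  assumed real-linear, its compatibility with \<open>of_real\<close> is recovered from
  norms.\<close>

lemma real_or_complex_field_cases:
  obtains (real) "\<And>c :: 'k::real_or_complex_field. \<exists>a. c = of_real a"
  | (complex) j :: "'k::real_or_complex_field" where "j * j = -1" "\<And>c :: 'k::real_or_complex_field. \<exists>a b. c = of_real a + of_real b * j"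
      "\<And>a b. \<bar>a\<bar> \<le> norm (of_real a + of_real b * j)"
proof -
  obtain \<phi> :: "'k \<Rightarrow> complex" where one: "\<phi> 1 = 1"
    and add: "\<And>x y. \<phi> (x + y) = \<phi> x + \<phi> y" and mult: "\<And>x y. \<phi> (x * y) = \<phi> x * \<phi> y"
    and iso: "\<And>x. norm (\<phi> x) = norm x" and range: "range \<phi> = \<real> \<or> range \<phi> = UNIV"
    using ex_isometry_real_or_complex[where 'a = 'k] by blast
  have diff: "\<phi> (x - y) = \<phi> x - \<phi> y" for x y
    using add[of "x - y" y] by simp
  have inj: "x = y" if "\<phi> x = \<phi> y" for x y
    using iso[of "x - y"] that by (simp add: diff)
  \<comment> \<open>A complex number is determined by its distances from 0 and 1 if it is real.\<close>
  have of_real: "\<phi> (of_real r) = of_real r" for r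
  proof -
    let ?z = "\<phi> (of_real r)"
    have "norm ?z = \<bar>r\<bar>" by (simp add: iso)
    then have 1: "(Re ?z)\<^sup>2 + (Im ?z)\<^sup>2 = r\<^sup>2" by (metis cmod_power2 power2_abs)
    have "norm (?z - 1) = norm (of_real (r - 1) :: 'k)"
      by (metis diff iso of_real_1 of_real_diff one)
    then have "(Re ?z - 1)\<^sup>2 + (Im ?z)\<^sup>2 = (r - 1)\<^sup>2"
      using cmod_power2[of "?z - 1"] by (simp del: of_real_diff)
    then have "Re ?z = r" using 1 by (simp add: power2_eq_square algebra_simps)
    then show ?thesis using 1 by (simp add: complex_eq_iff)
  qed
  show ?thesis
    using range
  proof
    assume R: "range \<phi> = \<real>"
    have "\<exists>a. c = of_real a" for c :: 'k
    proof -
      have "\<phi> c \<in> \<real>" using R by blast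
      then obtain a where "\<phi> c = of_real a" by (auto elim: Reals_cases)
      then show ?thesis using inj of_real by metis
    qed
    then show ?thesis by (rule real)
  next
    assume R: "range \<phi> = UNIV"
    then obtain j where j: "\<phi> j = \<i>" by (metis UNIV_I imageE)
    have \<phi>: "\<phi> (of_real a + of_real b * j) = Complex a b" for a b
      by (simp add: add mult of_real j complex_eq_iff)
    show ?thesis
    proof (rule complex)
      show "j * j = -1"
        by (rule inj) (use of_real[of "-1"] in \<open>simp add: mult j\<close>)
      show "\<exists>a b. c = of_real a + of_real b * j" for c :: 'k
        using inj \<phi> complex_surj by metis
      show "\<bar>a\<bar> \<le> norm (of_real a + of_real b * j)" for a b
        using abs_Re_le_cmod[of "Complex a b"] iso[of "of_real a + of_real b * j"]
        by (simp add: \<phi>)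
    qed
  qed
qed

text \<open>Homogeneity over \<open>'k\<close> contains the real homogeneity that a bounded linear
  map requires, since \<open>scale_of_real\<close> makes the two scalar multiplications
  agree.\<close>

lemma obtain_dual_space_element:
  fixes smul :: "'k::real_or_complex_field \<Rightarrow> 'a::banach \<Rightarrow> 'a"
  assumes "banach_space_over smul"
    and add: "\<And>x y. f (x + y) = f x + f y" and scale: "\<And>c x. f (smul c x) = c * f x"
    and bd: "\<And>x. norm (f x) \<le> norm x"
  obtains F where "F \<in> dual_space smul" "norm F \<le> 1" "\<And>x. blinfun_apply F x = f x"
proof -
  interpret banach_space_over smul by fact
  have "bounded_linear f"
    using scale[of "of_real _"]
    by (intro bounded_linear_intro[of _ 1])
       (auto simp: add bd scale_of_real scaleR_conv_of_real)
  then have F: "blinfun_apply (Blinfun f) = f" by (rule bounded_linear_Blinfun_apply)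
  have "vector_space ((*) :: 'k \<Rightarrow> 'k \<Rightarrow> 'k)"
    by standard (simp_all add: algebra_simps)
  then have "Vector_Spaces.linear smul (*) f"
    using vector_space_axioms by (simp add: Vector_Spaces.linear_iff add scale)
  then have "Blinfun f \<in> dual_space smul" by (simp add: dual_space_def F)
  moreover have "norm (Blinfun f) \<le> 1"
    by (rule norm_blinfun_bound) (simp_all add: F bd)
  ultimately show ?thesis using that F by metis
qed

text \<open>For complex scalars this is the Bohnenblust--Sobczyk construction: a real norming
  functional \<open>g\<close> is the real part of a scalar-linear \<open>f\<close> that obeys the
  same norm bound.\<close>

lemma norming_functional:
  fixes smul :: "'k::real_or_complex_field \<Rightarrow> 'a::banach \<Rightarrow> 'a"
  assumes X: "banach_space_over smul"
  shows "\<exists>f\<in>dual_space smul. norm f \<le> 1 \<and> norm x0 \<le> norm (blinfun_apply f x0)"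
proof -
  interpret banach_space_over smul by fact
  obtain g :: "'a \<Rightarrow> real" where g: "linear g" and le: "\<And>x. g x \<le> norm x" and g0: "g x0 = norm x0"
    using real_norming_functional by blast
  have g_add: "g (x + y) = g x + g y" for x y by (rule linear_add[OF g])
  have g_scale: "g (smul (of_real r) x) = r * g x" for r x
    by (simp add: scale_of_real linear_scale[OF g])
  have abs_g: "\<bar>g x\<bar> \<le> norm x" for x
    using le[of x] le[of "- x"] linear_neg[OF g, of x] by simp
  show ?thesis
  proof (cases rule: real_or_complex_field_cases[where 'k = 'k])
    case real
    let ?f = "\<lambda>x. of_real (g x) :: 'k"
    have "?f (smul c x) = c * ?f x" for c x
      using real[of c] by (auto simp: g_scale)
    then obtain F where "F \<in> dual_space smul" "norm F \<le> 1" "\<And>x. blinfun_apply F x = ?f x"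
      using obtain_dual_space_element[OF X, of ?f] g_add abs_g by auto
    then show ?thesis using g0 by (intro bexI[of _ F]) auto
  next
    case (complex j)
    \<comment> \<open>Linearity demands \<open>f (smul j x) = j * f x\<close>; comparing real parts
      shows that the coefficient of \<open>j\<close> in \<open>f x\<close> must be
      \<open>- g (smul j x)\<close>.\<close>
    define f where "f x = of_real (g x) - of_real (g (smul j x)) * j" for x
    have add: "f (x + y) = f x + f y" for x y
      by (simp add: f_def g_add scale_right_distrib algebra_simps)
    have f_real: "f (smul (of_real a) x) = of_real a * f x" for a x
    proof -
      have "smul j (smul (of_real a) x) = smul (of_real a) (smul j x)"
        by (rule scale_left_commute)
      then show ?thesis by (simp only: f_def g_scale) (simp add: algebra_simps)
    qed
    have f_j: "f (smul j x) = j * f x" for x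
    proof -
      have "smul j (smul j x) = - x" by (simp add: complex(1))
      moreover have "j * (r * j) = - r" for r
      proof -
        have "j * (r * j) = r * (j * j)" by (simp only: mult_ac)
        then show ?thesis by (simp add: complex(1))
      qed
      ultimately show ?thesis by (simp add: f_def linear_neg[OF g] right_diff_distrib)
    qed
    have scale: "f (smul c x) = c * f x" for c x
    proof -
      obtain a b where c: "c = of_real a + of_real b * j" using complex(2) by blast
      have "smul c x = smul (of_real a) x + smul (of_real b) (smul j x)"
        by (simp add: c scale_left_distrib)
      then have "f (smul c x) = f (smul (of_real a) x) + f (smul (of_real b) (smul j x))"
        by (simp only: add)
      also have "\<dots> = of_real a * f x + of_real b * (j * f x)"
        by (simp only: f_real f_j)
      finally show ?thesis by (simp add: c algebra_simps)
    qed
    \<comment> \<open>The real part of \<open>of_real a - f x\<close> is \<open>a - g x\<close>.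
      Taking \<open>a = norm (f x)\<close> at the rotated vector shows that \<open>g\<close> has
      this value there; taking \<open>a = 0\<close> at \<open>x0\<close> gives the norming
      estimate.\<close>
    have ge: "\<bar>a - g x\<bar> \<le> norm (of_real a - f x)" for a x
      using complex(3)[of "a - g x" "g (smul j x)"] by (simp add: f_def algebra_simps)
    have bd: "norm (f x) \<le> norm x" for x
    proof (cases "f x = 0")
      case False
      \<comment> \<open>Rotate \<open>x\<close> by a unimodular scalar so that the value becomes the real \<open>\<parallel>f x\<parallel>\<close>.\<close>
      define c where "c = of_real (norm (f x)) / f x"
      have "f (smul c x) = of_real (norm (f x))"
        using False by (simp add: scale c_def)
      then have "norm (f x) = g (smul c x)"
        using ge[of "norm (f x)" "smul c x"] by simp
      also have "\<dots> \<le> norm (smul c x)" by (rule le)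
      also have "\<dots> = norm x" using False by (simp add: norm_scale c_def norm_divide)
      finally show ?thesis .
    qed simp
    obtain F where "F \<in> dual_space smul" "norm F \<le> 1" "\<And>x. blinfun_apply F x = f x"
      using obtain_dual_space_element[OF X add scale bd] by metis
    then show ?thesis using ge[of 0 x0] g0 by (intro bexI[of _ F]) auto
  qed
qed

text \<open>The nontrivial half of the equality between the norms of \<open>S\<close> and of its
  dual: each vector \<open>S x\<close> is tested with a functional that norms it.\<close>

lemma norm_le_if_dual_le:
  fixes smul :: "'k::real_or_complex_field \<Rightarrow> 'a::banach \<Rightarrow> 'a"
  assumes X: "banach_space_over smul" and C: "C \<ge> 0"
    and le: "\<And>f. f \<in> dual_space smul \<Longrightarrow> norm (dual_operator S f) \<le> C * norm f"
  shows "norm S \<le> C"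
proof (rule norm_blinfun_bound[OF C])
  fix x
  obtain f where f: "f \<in> dual_space smul" "norm f \<le> 1"
    and ge: "norm (blinfun_apply S x) \<le> norm (blinfun_apply f (blinfun_apply S x))"
    using norming_functional[OF X] by blast
  note ge
  also have "norm (blinfun_apply f (blinfun_apply S x)) \<le> norm (dual_operator S f) * norm x"
    using norm_blinfun[of "dual_operator S f" x] by (simp add: dual_operator_def)
  also have "\<dots> \<le> C * 1 * norm x"
    using le[OF f(1)] mult_left_mono[OF f(2) C] by (intro mult_right_mono) auto
  finally show "norm (blinfun_apply S x) \<le> C * norm x" by simp
qed

section \<open>Exponential stability\<close>

lemma evol_refl [simp]: "evol A n n = id_blinfun"
  by (cases n) auto

lemma evol_cocycle:
  assumes "p \<le> n" "n \<le> m"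
  shows "evol A m p = evol A m n o\<^sub>L evol A n p"
  using assms(2)
proof (induction m rule: dec_induct)
  case base
  then show ?case by (simp add: blinfun_eqI)
next
  case (step m)
  then show ?case using assms(1) by (intro blinfun_eqI) simp
qed

lemma norm_evol_le_mult:
  assumes "p \<le> n" "n \<le> m"
  shows "norm (evol A m p) \<le> norm (evol A m n) * norm (evol A n p)"
  unfolding evol_cocycle[OF assms] by (rule norm_blinfun_compose)

text \<open>The case \<open>p = n\<close>, where \<open>evol A n n\<close> is the identity, turns
  the vectorwise estimate into one for operator norms; the cocycle property reverses this with the
  same \<open>N\<close> and \<alpha>.\<close>

lemma uniformly_exponentially_stable_iff:
  "uniformly_exponentially_stable A \<longleftrightarrow>
     (\<exists>N \<alpha>. N \<ge> 1 \<and> \<alpha> > 0 \<and>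
        (\<forall>m n. n \<le> m \<longrightarrow> norm (evol A m n) \<le> N * exp (- \<alpha> * (real m - real n))))"
  (is "_ \<longleftrightarrow> (\<exists>N \<alpha>. N \<ge> 1 \<and> \<alpha> > 0 \<and> ?P N \<alpha>)")
proof -
  have eq: "(\<forall>m n p x. m \<ge> n \<and> n \<ge> p \<longrightarrow>
      norm (evol A m p x) \<le> N * exp (- \<alpha> * (real m - real n)) * norm (evol A n p x)) \<longleftrightarrow> ?P N \<alpha>"
    (is "?Q \<longleftrightarrow> _") if N: "N \<ge> 1" for N \<alpha>
  proof
    assume Q: ?Q
    show "?P N \<alpha>"
    proof (intro allI impI norm_blinfun_bound)
      fix m n :: nat and x assume "n \<le> m"
      then show "norm (evol A m n x) \<le> N * exp (- \<alpha> * (real m - real n)) * norm x"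
        using Q[rule_format, of n m n x] by simp
    qed (use N in simp)
  next
    assume P: "?P N \<alpha>"
    show ?Q
    proof (intro allI impI)
      fix m n p :: nat and x assume "n \<le> m \<and> p \<le> n"
      then have "norm (evol A m p x) \<le> norm (evol A m n) * norm (evol A n p x)"
        by (simp add: evol_cocycle[of p n m] norm_blinfun)
      also have "\<dots> \<le> N * exp (- \<alpha> * (real m - real n)) * norm (evol A n p x)"
        using P \<open>n \<le> m \<and> p \<le> n\<close> by (intro mult_right_mono) auto
      finally show "norm (evol A m p x) \<le> N * exp (- \<alpha> * (real m - real n)) * norm (evol A n p x)" .
    qed
  qed
  show ?thesis
    unfolding uniformly_exponentially_stable_def by (intro iff_exI conj_cong refl) (rule eq)
qed

text \<open>Half of the decay rate absorbs the weight; the other half leaves a geometric series of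
  ratio \<open>q = exp (- b)\<close>.\<close>

lemma stable_imp_weighted_sum_bound:
  assumes "uniformly_exponentially_stable A"
  shows "\<exists>B b :: real. B \<ge> 1 \<and> b > 0 \<and>
    (\<forall>m. \<forall>f :: 'a::banach \<Rightarrow>\<^sub>L 'k::real_or_complex_field.
      (\<Sum>k=0..m. exp (b * (real m - real k)) * norm (dual_operator (evol A m k) f)) \<le> B * norm f)"
proof -
  obtain N \<alpha> where N: "N \<ge> 1" and \<alpha>: "\<alpha> > 0"
    and bd: "\<And>m n. n \<le> m \<Longrightarrow> norm (evol A m n) \<le> N * exp (- \<alpha> * (real m - real n))"
    using assms unfolding uniformly_exponentially_stable_iff by blast
  define b where "b = \<alpha> / 2"
  define q where "q = exp (- b)"
  have b: "b > 0" "\<alpha> = 2 * b" using \<alpha> by (simp_all add: b_def)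
  have q: "0 < q" "q < 1" using b by (simp_all add: q_def)
  have "(\<Sum>k=0..m. exp (b * (real m - real k)) * norm (dual_operator (evol A m k) f))
      \<le> N / (1 - q) * norm f" for m and f :: "'a \<Rightarrow>\<^sub>L 'k"
  proof -
    have "exp (b * (real m - real k)) * norm (dual_operator (evol A m k) f)
        \<le> N * norm f * q ^ (m - k)" if "k \<le> m" for k
    proof -
      have "norm (dual_operator (evol A m k) f) \<le> norm f * norm (evol A m k)"
        unfolding dual_operator_def by (rule norm_blinfun_compose)
      also have "\<dots> \<le> norm f * (N * exp (- \<alpha> * (real m - real k)))"
        by (intro mult_left_mono bd that) simp
      finally have "exp (b * (real m - real k)) * norm (dual_operator (evol A m k) f)
          \<le> exp (b * (real m - real k)) * (norm f * (N * exp (- \<alpha> * (real m - real k))))"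
        by (intro mult_left_mono) auto
      also have "\<dots> = N * norm f * (exp (b * (real m - real k)) * exp (- \<alpha> * (real m - real k)))"
        by simp
      also have "exp (b * (real m - real k)) * exp (- \<alpha> * (real m - real k)) = q ^ (m - k)"
        using that by (simp add: q_def b(2) of_nat_diff algebra_simps
            flip: exp_add exp_of_nat_mult)
      finally show ?thesis .
    qed
    then have "(\<Sum>k=0..m. exp (b * (real m - real k)) * norm (dual_operator (evol A m k) f))
        \<le> (\<Sum>k=0..m. N * norm f * q ^ (m - k))"
      by (intro sum_mono) simp
    also have "\<dots> = N * norm f * (\<Sum>k=0..m. q ^ (m - k))" by (simp add: sum_distrib_left)
    also have "(\<Sum>k=0..m. q ^ (m - k)) = (\<Sum>k\<le>m. q ^ k)"
      by (rule sum.reindex_bij_witness[of _ "\<lambda>k. m - k" "\<lambda>k. m - k"]) auto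
    also have "\<dots> \<le> 1 / (1 - q)"
      using q by (simp add: sum_gp0 divide_right_mono)
    finally show ?thesis using N by (simp add: mult_left_mono)
  qed
  \<comment> \<open>The constant has to be at least 1, which follows from \<open>N \<ge> 1\<close>
    and \<open>0 < 1 - q < 1\<close>.\<close>
  moreover have "1 \<le> N / (1 - q)" using N q by (simp add: field_simps)
  ultimately show ?thesis using b(1) by blast
qed

section \<open>From summability to exponential decay\<close>

text \<open>Each of the \<open>q\<close> full blocks of length \<open>h\<close> contributes a factor
  \<theta>, the remainder of length \<open>r\<close> a factor \<open>C\<close>. The block next to
  \<open>n\<close> is split off, so the induction hypothesis is applied at
  \<open>n + h\<close>.\<close>

lemma norm_evol_le_power:
  assumes "\<And>m n. n \<le> m \<Longrightarrow> norm (evol A m n) \<le> C"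
    and "\<And>n. norm (evol A (n + h) n) \<le> \<theta>"
  shows "norm (evol A (n + q * h + r) n) \<le> C * \<theta> ^ q"
proof (induction q arbitrary: n)
  case 0
  then show ?case using assms(1) by simp
next
  case (Suc q)
  have eq: "n + Suc q * h + r = (n + h) + q * h + r" by simp
  have "norm (evol A (n + Suc q * h + r) n)
      \<le> norm (evol A ((n + h) + q * h + r) (n + h)) * norm (evol A (n + h) n)"
    unfolding eq by (rule norm_evol_le_mult) auto
  also have "\<dots> \<le> (C * \<theta> ^ q) * \<theta>"
    using order_trans[OF norm_ge_zero Suc.IH] by (intro mult_mono Suc.IH assms(2)) auto
  finally show ?case by (simp add: mult_ac)
qed

text \<open>Halving every \<open>h\<close> steps means decay at rate \<open>ln 2 / real h\<close>;
  the incomplete last block costs the extra factor 2 in the constant \<open>2 * C\<close>.\<close>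

lemma stable_if_half_contraction:
  assumes C: "C \<ge> 1" and bd: "\<And>m n. n \<le> m \<Longrightarrow> norm (evol A m n) \<le> C"
    and h: "h > 0" and half: "\<And>n. norm (evol A (n + h) n) \<le> 1 / 2"
  shows "uniformly_exponentially_stable A"
  unfolding uniformly_exponentially_stable_iff
proof (intro exI conjI allI impI)
  show "2 * C \<ge> 1" using C by simp
  show "ln 2 / real h > 0" using h by simp
  fix m n :: nat
  assume "n \<le> m"
  define q r where "q = (m - n) div h" and "r = (m - n) mod h"
  have m: "m = n + q * h + r" using \<open>n \<le> m\<close> by (simp add: q_def r_def)
  have "norm (evol A m n) \<le> C * (1 / 2) ^ q"
    unfolding m by (rule norm_evol_le_power[OF bd half])
  \<comment> \<open>The exponent is raised to \<open>q + 1\<close> because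
    \<open>m - n \<le> h * (q + 1)\<close> always holds, whereas \<open>m - n \<le> h * q\<close>
    fails if \<open>r > 0\<close>.\<close>
  also have "(1 / 2) ^ q = 2 * exp (- (ln 2 * (real q + 1)))"
  proof -
    have "exp (- (ln 2 * (real q + 1))) = exp (real (Suc q) * - ln 2)" by (simp add: mult_ac)
    also have "\<dots> = (1 / 2) ^ Suc q" unfolding exp_of_nat_mult by (simp add: exp_minus)
    finally show ?thesis by simp
  qed
  also have "\<dots> \<le> 2 * exp (- (ln 2 / real h) * (real m - real n))"
  proof -
    have "r < h" using h by (simp add: r_def)
    then have "real m - real n \<le> real h * (real q + 1)"
      by (simp add: m algebra_simps)
    then have "ln 2 / real h * (real m - real n) \<le> ln 2 / real h * (real h * (real q + 1))"
      by (intro mult_left_mono) auto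
    also have "\<dots> = ln 2 * (real q + 1)" using h by simp
    finally show ?thesis by simp
  qed
  finally show "norm (evol A m n) \<le> 2 * C * exp (- (ln 2 / real h) * (real m - real n))"
    using C by (simp add: mult_ac)
qed

text \<open>A single summand gives a uniform bound, averaging improves it to decay of order
  \<open>1 / (h + 1)\<close>, and a fixed large \<open>h\<close> then makes every block of length
  \<open>h\<close> a contraction by one half.\<close>

lemma sum_bound_imp_stable:
  fixes smul :: "'k::real_or_complex_field \<Rightarrow> 'a::banach \<Rightarrow> 'a"
  assumes X: "banach_space_over smul" and B: "B \<ge> 1"
    and sum_le: "\<And>m f. f \<in> dual_space smul \<Longrightarrow>
      (\<Sum>k=0..m. norm (dual_operator (evol A m k) f)) \<le> B * norm f"
  shows "uniformly_exponentially_stable A"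
proof -
  have bd: "norm (evol A m n) \<le> B" if "n \<le> m" for m n
  proof (rule norm_le_if_dual_le[OF X])
    fix f assume f: "f \<in> dual_space smul"
    have "norm (dual_operator (evol A m n) f) \<le> (\<Sum>k=0..m. norm (dual_operator (evol A m k) f))"
      by (rule member_le_sum) (use that in auto)
    then show "norm (dual_operator (evol A m n) f) \<le> B * norm f"
      using sum_le[OF f, of m] by simp
  qed (use B in simp)
  have decay: "norm (evol A (n + h) n) \<le> B\<^sup>2 / real (Suc h)" for n h
  proof (rule norm_le_if_dual_le[OF X])
    fix f assume f: "f \<in> dual_space smul"
    let ?m = "n + h"
    let ?d = "\<lambda>k. norm (dual_operator (evol A ?m k) f)"
    have "?d n \<le> B * ?d k" if "n \<le> k" "k \<le> ?m" for k
    proof -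
      have "dual_operator (evol A ?m n) f = dual_operator (evol A ?m k) f o\<^sub>L evol A k n"
        by (rule blinfun_eqI) (simp add: dual_operator_def evol_cocycle[OF that])
      then have "?d n \<le> ?d k * norm (evol A k n)" by (simp add: norm_blinfun_compose)
      also have "\<dots> \<le> ?d k * B" using bd[OF that(1)] by (simp add: mult_left_mono)
      finally show ?thesis by (simp add: mult.commute)
    qed
    \<comment> \<open>The left side adds the same number over \<open>h + 1\<close> indices, hence
      the denominator \<open>Suc h\<close>.\<close>
    then have "(\<Sum>k=n..?m. ?d n) \<le> (\<Sum>k=n..?m. B * ?d k)" by (intro sum_mono) auto
    also have "\<dots> = B * (\<Sum>k=n..?m. ?d k)" by (simp add: sum_distrib_left)
    \<comment> \<open>Starting the sum at 0 adds only nonnegative terms and reaches the sum bounded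
      by \<open>sum_le\<close>.\<close>
    also have "\<dots> \<le> B * (\<Sum>k=0..?m. ?d k)"
      using B by (intro mult_left_mono sum_mono2) auto
    also have "\<dots> \<le> B * (B * norm f)"
      using B sum_le[OF f] by (intro mult_left_mono) auto
    finally show "?d n \<le> B\<^sup>2 / real (Suc h) * norm f"
      by (simp add: field_simps power2_eq_square)
  qed (use B in simp)
  \<comment> \<open>Chosen so that the decay bound \<open>B\<^sup>2 / real (Suc h)\<close> is at
    most one half.\<close>
  obtain h where h: "2 * B\<^sup>2 < real h" using reals_Archimedean2 by blast
  then have "h > 0" using B by (cases h) (auto simp: not_less)
  have "B\<^sup>2 / real (Suc h) \<le> 1 / 2" using h by (simp add: field_simps)
  then have "norm (evol A (n + h) n) \<le> 1 / 2" for n using decay[of n h] by linarith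
  with B bd \<open>h > 0\<close> show ?thesis by (rule stable_if_half_contraction)
qed

theorem theorem3:
  fixes smul :: "'k::real_or_complex_field \<Rightarrow> 'a::banach \<Rightarrow> 'a"
    and A :: "nat \<Rightarrow> 'a \<Rightarrow>\<^sub>L 'a"
  assumes "banach_space_over smul"
    and "\<forall>n. A n \<in> bounded_operators smul"
  shows "(uniformly_exponentially_stable A \<longleftrightarrow>
           (\<exists>B b :: real. B \<ge> 1 \<and> b > 0 \<and>
             (\<forall>m. \<forall>f \<in> dual_space smul.
               (\<Sum>k=0..m. exp (b * (real m - real k)) * norm (dual_operator (evol A m k) f))
                 \<le> B * norm f)))
       \<and> (uniformly_exponentially_stable A \<longleftrightarrow>
           (\<exists>B :: real. B \<ge> 1 \<and>
             (\<forall>m. \<forall>f \<in> dual_space smul.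
               (\<Sum>k=0..m. norm (dual_operator (evol A m k) f)) \<le> B * norm f)))"
    (is "(?i \<longleftrightarrow> ?ii) \<and> (?i \<longleftrightarrow> ?iii)")
proof -
  \<comment> \<open>The implications form a cycle, from which both equivalences follow.\<close>
  have "?ii" if "?i"
    using stable_imp_weighted_sum_bound[OF that, where 'k = 'k] by blast
  moreover have "?iii" if "?ii"
  proof -
    from that obtain B b where B: "B \<ge> 1" and b: "b > 0" and le: "\<And>m f. f \<in> dual_space smul \<Longrightarrow>
      (\<Sum>k=0..m. exp (b * (real m - real k)) * norm (dual_operator (evol A m k) f)) \<le> B * norm f"
      by blast
    have "(\<Sum>k=0..m. norm (dual_operator (evol A m k) f)) \<le> B * norm f"
      if "f \<in> dual_space smul" for m f
    proof (rule order_trans[OF sum_mono le[OF that]])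
      fix k assume "k \<in> {0..m}"
      \<comment> \<open>For \<open>k \<le> m\<close> the weights are at least 1, so removing them
        cannot increase the sum.\<close>
      then have "1 \<le> exp (b * (real m - real k))" using b by simp
      then show "norm (dual_operator (evol A m k) f)
          \<le> exp (b * (real m - real k)) * norm (dual_operator (evol A m k) f)"
        using mult_right_mono[of 1 _ "norm (dual_operator (evol A m k) f)"] by simp
    qed
    then show ?thesis using B by blast
  qed
  moreover have "?i" if "?iii"
    using that sum_bound_imp_stable[OF assms(1)] by blast
  ultimately show ?thesis by blast
qed

end
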